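(* For any tree $T$ and integer $q\ge 2$, there exists a positive constant $c=c_{T,q}$ such that $$\mathrm{ex}(n,T,q)\le |U_{q,n}|-c\binom{n}{2}=\left(\left\lfloor \frac{q^2}{2}\right\rfloor-c\right)\binom{n}{2}.$$
   Context: All graphs are finite and simple. Let $n,q\ge 1$ be integers. For $\mathbf{x}\in\{0,1,\dots,q\}^n$ the support is $S_{\mathbf{x}}=\{i: x_i\neq 0\}$. Let $Q(n,2)=\{\mathbf{x}\in\{0,1,\dots,q\}^n: |S_{\mathbf{x}}|=2\}$; its elements are called $q$-edges, and a $q$-graph on $n$ vertices is a subset $H\subseteq Q(n,2)$. For a graph $F$ without isolated vertices and an integer $s\ge1$, a $q$-graph $H$ is an $s$-copy of $F$ if $|H|=|E(F)|$ and there is an isomorphism $\iota$ from $F$ to the graph with vertex set $\bigcup_{\mathbf{x}\in H}S_{\mathbf{x}}$ and edge set $\{S_{\mathbf{x}}:\mathbf{x}\in H\}$ such that, writing $\mathbf{x}^e$ for the unique element of $H$ with support $\iota(e)$, for all distinct $e,e'\in E(F)$ and $v\in e\cap e'$ we have $x^{e}_{\iota(v)}+x^{e'}_{\iota(v)}\ge s$. If $F$ has isolated vertices, $H\subseteq Q(n,2)$ is an $s$-copy of $F$ if $n\ge |V(F)|$ and $H$ is an $s$-copy of the subgraph of $F$ induced by its non-isolated vertices. A $q$-graph contains an $s$-copy of $F$ if some subset of it is an $s$-copy of $F$. $\mathrm{ex}(n,F,q)$ is the maximum of $|H|$ over all $H\subseteq Q(n,2)$ containing no $(q+1)$-copy of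 $F$. The universal $q$-tree is $U_{q,n}=U^<\cup\bigcup_{1\le i<j\le n}U^{i,j,=}$, where $U^<=\{\mathbf{x}\in Q(n,2):\sum_i x_i<q+1\}$ and $U^{i,j,=}=\{\mathbf{x}\in Q(n,2): S_{\mathbf{x}}=\{i,j\},\ x_i<x_j,\ x_i+x_j=q+1\}$.
   Formalization: The inequality is proved for all sufficiently large n (n ≥ N with N depending on T and q), since it fails for small n, e.g. n = 2 when T has at least 3 vertices; the equality holds for all n ≥ 1. For the one-vertex tree, ex is read as 0. *)

theory Defs
  imports Complex_Main "HOL-Library.FuncSet"
begin

text \<open>The digraphs of the AFP entry \<open>Graph_Theory\<close> are not used: a symmetric pair of
  arcs counts as a cycle there, so its \<open>tree\<close> is not the notion for undirected graphs.\<close>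

definition simple_graph :: "'a set \<Rightarrow> 'a set set \<Rightarrow> bool" where
  "simple_graph V E \<longleftrightarrow> finite V \<and> (\<forall>e\<in>E. e \<subseteq> V \<and> card e = 2)"

definition connected_graph :: "'a set \<Rightarrow> 'a set set \<Rightarrow> bool" where
  "connected_graph V E \<longleftrightarrow>
     V \<noteq> {} \<and> (\<forall>u\<in>V. \<forall>v\<in>V. (u, v) \<in> {(a, b). {a, b} \<in> E}\<^sup>*)"

definition is_cycle :: "'a set set \<Rightarrow> 'a list \<Rightarrow> bool" where
  "is_cycle E p \<longleftrightarrow> 3 \<le> length p \<and> distinct p \<and>
     (\<forall>i<length p. {p ! i, p ! (Suc i mod length p)} \<in> E)"

definition is_tree :: "'a set \<Rightarrow> 'a set set \<Rightarrow> bool" where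
  "is_tree V E \<longleftrightarrow> simple_graph V E \<and> connected_graph V E \<and> (\<nexists>p. is_cycle E p)"

definition graph_iso ::
    "'a set \<Rightarrow> 'a set set \<Rightarrow> 'b set \<Rightarrow> 'b set set \<Rightarrow> ('a \<Rightarrow> 'b) \<Rightarrow> bool" where
  "graph_iso V E V' E' f \<longleftrightarrow>
     bij_betw f V V' \<and> (\<forall>u\<in>V. \<forall>v\<in>V. {u, v} \<in> E \<longleftrightarrow> {f u, f v} \<in> E')"

definition non_isolated :: "'a set \<Rightarrow> 'a set set \<Rightarrow> 'a set" where
  "non_isolated V E = {v \<in> V. \<exists>e\<in>E. v \<in> e}"

definition induced_edges :: "'a set set \<Rightarrow> 'a set \<Rightarrow> 'a set set" where
  "induced_edges E W = {e \<in> E. e \<subseteq> W}"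

text \<open>A vector of length \<open>n\<close> is a function on \<open>{1..n}\<close> that is extensional
  (\<open>undefined\<close> outside), so that distinct functions are distinct vectors. This is
  why the support has to mention \<open>n\<close>.\<close>

definition supp :: "nat \<Rightarrow> (nat \<Rightarrow> nat) \<Rightarrow> nat set" where
  "supp n x = {i \<in> {1..n}. x i \<noteq> 0}"

definition q_edges :: "nat \<Rightarrow> nat \<Rightarrow> (nat \<Rightarrow> nat) set" where
  "q_edges q n = {x \<in> {1..n} \<rightarrow>\<^sub>E {0..q}. card (supp n x) = 2}"

definition s_copy_no_isolated ::
    "nat \<Rightarrow> nat \<Rightarrow> nat \<Rightarrow> 'a set \<Rightarrow> 'a set set \<Rightarrow> (nat \<Rightarrow> nat) set \<Rightarrow> bool" where
  "s_copy_no_isolated q n s V E H \<longleftrightarrow>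
     H \<subseteq> q_edges q n \<and> card H = card E \<and>
     (\<exists>\<iota>. graph_iso V E (\<Union>x\<in>H. supp n x) (supp n ` H) \<iota> \<and>
        (let X = (\<lambda>e. THE x. x \<in> H \<and> supp n x = \<iota> ` e)
         in \<forall>e\<in>E. \<forall>e'\<in>E. e \<noteq> e' \<longrightarrow> (\<forall>v\<in>e \<inter> e'. s \<le> X e (\<iota> v) + X e' (\<iota> v))))"

definition s_copy ::
    "nat \<Rightarrow> nat \<Rightarrow> nat \<Rightarrow> 'a set \<Rightarrow> 'a set set \<Rightarrow> (nat \<Rightarrow> nat) set \<Rightarrow> bool" where
  "s_copy q n s V E H \<longleftrightarrow>
     (if non_isolated V E = V then s_copy_no_isolated q n s V E H
      else card V \<le> n \<and>
        s_copy_no_isolated q n s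
          (non_isolated V E) (induced_edges E (non_isolated V E)) H)"

definition contains_s_copy ::
    "nat \<Rightarrow> nat \<Rightarrow> nat \<Rightarrow> 'a set \<Rightarrow> 'a set set \<Rightarrow> (nat \<Rightarrow> nat) set \<Rightarrow> bool" where
  "contains_s_copy q n s V E H \<longleftrightarrow> (\<exists>H'\<subseteq>H. s_copy q n s V E H')"

text \<open>The supremum ranges over a finite set of natural numbers, so it is the maximum
  whenever some \<open>q\<close>-graph qualifies. None does for an edgeless graph with at most \<open>n\<close>
  vertices, as the empty \<open>q\<close>-graph is then a copy; \<open>Sup {} = 0\<close> covers that case.\<close>

definition ex :: "nat \<Rightarrow> 'a set \<Rightarrow> 'a set set \<Rightarrow> nat \<Rightarrow> nat" where
  "ex n V E q = Sup {card H |H. H \<subseteq> q_edges q n \<and> \<not> contains_s_copy q n (q + 1) V E H}"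

definition U_less :: "nat \<Rightarrow> nat \<Rightarrow> (nat \<Rightarrow> nat) set" where
  "U_less q n = {x \<in> q_edges q n. (\<Sum>i=1..n. x i) < q + 1}"

definition U_eq :: "nat \<Rightarrow> nat \<Rightarrow> nat \<Rightarrow> nat \<Rightarrow> (nat \<Rightarrow> nat) set" where
  "U_eq q n i j = {x \<in> q_edges q n. supp n x = {i, j} \<and> x i < x j \<and> x i + x j = q + 1}"

definition universal_q_tree :: "nat \<Rightarrow> nat \<Rightarrow> (nat \<Rightarrow> nat) set" where
  "universal_q_tree q n =
     U_less q n \<union> (\<Union>(i, j)\<in>{(i, j). 1 \<le> i \<and> i < j \<and> j \<le> n}. U_eq q n i j)"

end

theory Submission
  imports Defs
begin

text \<open>
  Root the tree, so that every vertex has at most one parent, and give each vertex a threshold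
  \<open>t\<close> with \<open>2 * t \<ge> q + 1\<close>. Suppose that every \<open>q\<close>-edge from a parent with threshold \<open>t\<close> to a
  child with threshold \<open>s\<close> has value at least \<open>t\<close> at the parent and at least \<open>q + 1 - s\<close> at the
  child. Then the sum condition holds at every vertex: two edges to children contribute at least
  \<open>2 * t\<close>, and an edge to a child together with the edge to the parent at least
  \<open>t + (q + 1 - t)\<close>. Call a pair of a vertex and a threshold a state. A tree on at most \<open>r\<close>
  vertices can be embedded greedily as soon as some nonempty set of states is such that each of
  its members is linked in this way to states of the set at \<open>r\<close> or more vertices
  (\<open>rich_states_copy\<close>).

  If \<open>H\<close> contains no copy, there is no such set, and a degeneracy argument ranks the states so
  that each is linked to fewer than \<open>r\<close> vertices through states of rank at least its own.
  Deleting the \<open>q\<close>-edges behind these links costs only \<open>O(n)\<close> of them, and afterwards all links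
  strictly decrease the rank (\<open>ranked_subgraph\<close>). Now a \<open>q\<close>-edge \<open>x\<close> and its complement, which
  has the same support and the values \<open>q + 1 - x i\<close> there, cannot both be present: they would
  link the same two states in both directions (\<open>ranked_flip_free\<close>). So a pair of vertices
  supports at most \<open>q\<^sup>2 div 2\<close> of the \<open>q\<^sup>2\<close> possible \<open>q\<close>-edges, which is also the number that
  the universal tree has there.

  A gain that is quadratic in \<open>n\<close> comes from the \<open>q\<close>-edges with the values \<open>h\<close> and \<open>q + 1 - h\<close>,
  where \<open>h\<close> is the least integer above \<open>(q + 1) / 2\<close>. A pair that supports neither of the two
  has at most \<open>q\<^sup>2 div 2 - 1\<close> \<open>q\<close>-edges. If all pairs inside some set of \<open>r\<close> vertices support one
  of them, then the ranks of the states with threshold \<open>h\<close> decide at which end the value \<open>h\<close> is,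
  and the tree embeds with all children ranked below their parents (\<open>balanced_clique_copy\<close>).
  So every set of \<open>r\<close> vertices contains a deficient pair, and by double counting at least
  \<open>(n choose 2) / (r choose 2)\<close> pairs are deficient. For large \<open>n\<close> half of this exceeds the
  \<open>O(n)\<close> deleted \<open>q\<close>-edges.
\<close>

section \<open>Trees\<close>

text \<open>The form in which trees are used: for a greedy embedding only the order in which the
  vertices can be attached matters.\<close>

inductive leaf_built :: "'a set \<Rightarrow> 'a set set \<Rightarrow> bool" where
  single: "leaf_built {r} {}"
| attach: "leaf_built V E \<Longrightarrow> p \<in> V \<Longrightarrow> v \<notin> V \<Longrightarrow> leaf_built (insert v V) (insert {p, v} E)"

lemma leaf_built_finite: "leaf_built V E \<Longrightarrow> finite V"
  by (induction rule: leaf_built.induct) auto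

lemma leaf_built_edges: "leaf_built V E \<Longrightarrow> e \<in> E \<Longrightarrow> e \<subseteq> V"
  by (induction rule: leaf_built.induct) auto

definition simple_path :: "'a set set \<Rightarrow> 'a list \<Rightarrow> bool" where
  "simple_path E xs \<longleftrightarrow> distinct xs \<and> (\<forall>i. Suc i < length xs \<longrightarrow> {xs ! i, xs ! Suc i} \<in> E)"

lemma simple_path_mono: "simple_path E xs \<Longrightarrow> E \<subseteq> F \<Longrightarrow> simple_path F xs"
  by (auto simp: simple_path_def)

lemma simple_path_Cons:
  assumes "simple_path E xs" "v \<notin> set xs" "xs \<noteq> []" "{hd xs, v} \<in> E"
  shows "simple_path E (v # xs)"
  using assms by (auto simp: simple_path_def nth_Cons hd_conv_nth insert_commute split: nat.splits)

lemma simple_path_rev: assumes "simple_path E xs" shows "simple_path E (rev xs)"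
  unfolding simple_path_def
proof (intro conjI allI impI)
  show "distinct (rev xs)" using assms by (simp add: simple_path_def)
  fix i assume i: "Suc i < length (rev xs)"
  define j where "j = length xs - Suc (Suc i)"
  have j: "Suc j < length xs" "length xs - Suc i = Suc j" using i by (auto simp: j_def)
  then have "{xs ! j, xs ! Suc j} \<in> E" using assms by (simp add: simple_path_def)
  then show "{rev xs ! i, rev xs ! Suc i} \<in> E"
    using i j by (simp add: rev_nth j_def insert_commute)
qed

lemma leaf_built_path:
  assumes "leaf_built V E" "a \<in> V" "b \<in> V"
  shows "\<exists>xs. simple_path E xs \<and> xs \<noteq> [] \<and> set xs \<subseteq> V \<and> hd xs = a \<and> last xs = b"
  using assms
proof (induction arbitrary: a b rule: leaf_built.induct)
  case (single r)
  then show ?case by (intro exI[of _ "[r]"]) (auto simp: simple_path_def)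
next
  case (attach V E p v)
  have from_leaf: "\<exists>xs. simple_path (insert {p, v} E) xs \<and> xs \<noteq> [] \<and> set xs \<subseteq> insert v V
      \<and> hd xs = v \<and> last xs = c" if cV: "c \<in> V" for c
  proof -
    obtain xs where xs: "simple_path E xs" "xs \<noteq> []" "set xs \<subseteq> V" "hd xs = p" "last xs = c"
      using attach.IH[OF \<open>p \<in> V\<close> cV] by auto
    have "simple_path (insert {p, v} E) (v # xs)"
      using xs attach.hyps by (intro simple_path_Cons simple_path_mono[OF xs(1)]) auto
    then show ?thesis using xs by (intro exI[of _ "v # xs"]) auto
  qed
  consider "a = v" "b = v" | "a = v" "b \<in> V" | "a \<in> V" "b = v" | "a \<in> V" "b \<in> V"
    using attach.prems by auto
  then show ?case
  proof cases
    case 1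
    then show ?thesis by (intro exI[of _ "[v]"]) (auto simp: simple_path_def)
  next
    case 2
    then show ?thesis using from_leaf by simp
  next
    case 3
    then obtain xs where "simple_path (insert {p, v} E) xs" "xs \<noteq> []" "set xs \<subseteq> insert v V"
        "hd xs = v" "last xs = a" using from_leaf by meson
    then show ?thesis using 3
      by (intro exI[of _ "rev xs"]) (auto simp: simple_path_rev hd_rev last_rev)
  next
    case 4
    then obtain xs where "simple_path E xs" "xs \<noteq> []" "set xs \<subseteq> V" "hd xs = a" "last xs = b"
      using attach.IH by meson
    then show ?thesis by (intro exI[of _ xs]) (auto intro: simple_path_mono)
  qed
qed

lemma path_closes_cycle:
  assumes xs: "simple_path E xs" "xs \<noteq> []" "v \<notin> set xs"
    and ends: "{hd xs, v} \<in> E" "{last xs, v} \<in> E" "hd xs \<noteq> last xs"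
  shows "is_cycle E (v # xs)"
  unfolding is_cycle_def
proof (intro conjI allI impI)
  have path: "simple_path E (v # xs)" using simple_path_Cons xs ends(1) by metis
  then show "distinct (v # xs)" by (simp add: simple_path_def)
  have "length xs \<noteq> 1" using ends(3) by (auto simp: length_Suc_conv)
  moreover have "length xs \<noteq> 0" using xs(2) by simp
  moreover have "length (v # xs) = Suc (length xs)" by simp
  ultimately show "3 \<le> length (v # xs)" by linarith
  fix i assume i: "i < length (v # xs)"
  show "{(v # xs) ! i, (v # xs) ! (Suc i mod length (v # xs))} \<in> E"
  proof (cases "Suc i < length (v # xs)")
    case True
    then show ?thesis using path by (simp add: simple_path_def)
  next
    case False
    then have "i = length xs" using i by simp
    then show ?thesis using ends(2) xs(2) by (simp add: last_conv_nth nth_Cons')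
  qed
qed

lemma rtrancl_leaves_set:
  assumes "(a, b) \<in> r\<^sup>*" "a \<in> W" "b \<notin> W"
  shows "\<exists>x y. (x, y) \<in> r \<and> x \<in> W \<and> y \<notin> W"
  using assms by (induction rule: rtrancl_induct) auto

text \<open>A largest leaf-built induced subgraph is everything: otherwise, by connectedness, an edge
  leaves it, and the new endpoint has just this one neighbour inside, because two neighbours
  would be joined by a path inside and close a cycle.\<close>

lemma tree_leaf_built:
  assumes "is_tree V E"
  shows "leaf_built V E"
proof -
  have simple: "finite V" "\<And>e. e \<in> E \<Longrightarrow> e \<subseteq> V \<and> card e = 2"
    and conn: "connected_graph V E" and acyc: "\<And>p. \<not> is_cycle E p"
    using assms by (auto simp: is_tree_def simple_graph_def)
  obtain r where r: "r \<in> V" using conn by (auto simp: connected_graph_def)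
  let ?P = "\<lambda>W. W \<subseteq> V \<and> leaf_built W (E \<inter> Pow W)"
  have "E \<inter> Pow {r} = {}" using simple(2) by (fastforce simp: subset_singleton_iff)
  then have "?P {r}" using r by (simp add: leaf_built.single)
  moreover have "\<forall>W. ?P W \<longrightarrow> card W \<le> card V" using simple(1) by (simp add: card_mono)
  ultimately obtain W where W: "W \<subseteq> V" "leaf_built W (E \<inter> Pow W)"
      and W_max: "\<And>W'. ?P W' \<Longrightarrow> card W' \<le> card W"
    using ex_has_greatest_nat[of ?P "{r}" card "Suc (card V)"] by (auto simp: le_imp_less_Suc)
  have "W \<noteq> {}" using W(2) by (cases rule: leaf_built.cases) auto
  have "W = V"
  proof (rule ccontr)
    assume "W \<noteq> V"
    then obtain a b where "a \<in> W" "b \<in> V" "b \<notin> W" using W(1) \<open>W \<noteq> {}\<close> by auto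
    moreover have "(a, b) \<in> {(a, b). {a, b} \<in> E}\<^sup>*"
      using conn W(1) \<open>a \<in> W\<close> \<open>b \<in> V\<close> by (simp add: connected_graph_def subset_iff)
    ultimately obtain p v where pv: "{p, v} \<in> E" "p \<in> W" "v \<notin> W"
      using rtrancl_leaves_set[of a b "{(a, b). {a, b} \<in> E}" W] by auto
    have only: "e = {p, v}" if "e \<in> E" "e \<subseteq> insert v W" "v \<in> e" for e
    proof -
      obtain p' where p': "e = {p', v}" "p' \<noteq> v"
        using simple(2)[OF \<open>e \<in> E\<close>] \<open>v \<in> e\<close> by (auto simp: card_2_iff)
      then have "p' \<in> W" using that(2) by auto
      then obtain xs where xs: "simple_path (E \<inter> Pow W) xs" "xs \<noteq> []" "set xs \<subseteq> W" "hd xs = p"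
          "last xs = p'"
        using leaf_built_path[OF W(2) pv(2), of p'] by auto
      have "p = p'"
      proof (rule ccontr)
        assume "p \<noteq> p'"
        then have "is_cycle E (v # xs)"
          using xs pv p' that(1) simple_path_mono[OF xs(1)]
          by (intro path_closes_cycle) auto
        then show False using acyc by auto
      qed
      then show ?thesis using p' by simp
    qed
    have "E \<inter> Pow (insert v W) = insert {p, v} (E \<inter> Pow W)"
      using only pv by blast
    moreover have "leaf_built (insert v W) (insert {p, v} (E \<inter> Pow W))"
      using W(2) pv by (intro leaf_built.attach)
    moreover have "v \<in> V" using simple(2)[OF pv(1)] by auto
    ultimately have "card (insert v W) \<le> card W" using W(1) by (intro W_max) auto
    then show False using pv(3) leaf_built_finite[OF W(2)] by simp
  qed
  moreover have "E \<inter> Pow V = E" using simple(2) by auto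
  ultimately show ?thesis using W(2) by simp
qed

section \<open>Finding a copy\<close>

text \<open>The two cases in the definition of a copy agree here: an injection into \<open>{1..n}\<close> shows that
  \<open>n\<close> is large enough for the isolated vertices.\<close>

lemma contains_s_copyI:
  assumes simple: "simple_graph V E" and H: "H \<subseteq> q_edges q n"
    and f: "inj_on f V" "f ` V \<subseteq> {1..n}"
    and X: "\<And>e. e \<in> E \<Longrightarrow> X e \<in> H \<and> supp n (X e) = f ` e"
    and sums: "\<And>e e' v. e \<in> E \<Longrightarrow> e' \<in> E \<Longrightarrow> e \<noteq> e' \<Longrightarrow> v \<in> e \<Longrightarrow> v \<in> e' \<Longrightarrow>
      s \<le> X e (f v) + X e' (f v)"
  shows "contains_s_copy q n s V E H"
proof -
  let ?W = "non_isolated V E"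
  have sub: "e \<subseteq> V" if "e \<in> E" for e using simple that by (auto simp: simple_graph_def)
  have W: "?W = \<Union>E" using sub by (auto simp: non_isolated_def)
  have ind: "induced_edges E ?W = E" unfolding W by (auto simp: induced_edges_def)
  have inj_sub: "e = e'" if "f ` e = f ` e'" "e \<subseteq> V" "e' \<subseteq> V" for e e'
    using inj_on_image_eq_iff[OF f(1)] that by blast
  have suppX: "supp n (X e) = f ` e" if "e \<in> E" for e using X that by blast
  have "inj_on X E"
  proof (rule inj_onI)
    fix e e' assume "e \<in> E" "e' \<in> E" "X e = X e'"
    then have "f ` e = f ` e'" using suppX by metis
    then show "e = e'" using inj_sub sub \<open>e \<in> E\<close> \<open>e' \<in> E\<close> by blast
  qed
  then have card: "card (X ` E) = card E" by (simp add: card_image)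
  have the: "(THE x. x \<in> X ` E \<and> supp n x = f ` e) = X e" if "e \<in> E" for e
  proof (rule the_equality)
    show "X e \<in> X ` E \<and> supp n (X e) = f ` e" using that suppX by auto
    fix x assume x: "x \<in> X ` E \<and> supp n x = f ` e"
    then obtain e' where e': "e' \<in> E" "x = X e'" by auto
    then have "f ` e' = f ` e" using x suppX by metis
    then show "x = X e" using e' inj_sub sub that by blast
  qed
  have supps: "supp n ` X ` E = (`) f ` E"
    unfolding image_image using suppX by (intro image_cong) auto
  have "graph_iso ?W E (\<Union>x\<in>X ` E. supp n x) (supp n ` X ` E) f"
    unfolding graph_iso_def
  proof (intro conjI ballI)
    have "(\<Union>x\<in>X ` E. supp n x) = f ` ?W"
      unfolding supps W by auto
    then show "bij_betw f ?W (\<Union>x\<in>X ` E. supp n x)"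
      using f(1) by (auto simp: bij_betw_def non_isolated_def intro: inj_on_subset)
    fix u v assume uv: "u \<in> ?W" "v \<in> ?W"
    then have "{u, v} \<subseteq> V" by (auto simp: non_isolated_def)
    show "{u, v} \<in> E \<longleftrightarrow> {f u, f v} \<in> supp n ` X ` E"
    proof
      assume "{u, v} \<in> E"
      then show "{f u, f v} \<in> supp n ` X ` E" unfolding supps by (force intro: rev_image_eqI)
    next
      assume "{f u, f v} \<in> supp n ` X ` E"
      then obtain e where "e \<in> E" "f ` {u, v} = f ` e" unfolding supps by auto
      then show "{u, v} \<in> E" using inj_sub[of "{u, v}" e] sub \<open>{u, v} \<subseteq> V\<close> by auto
    qed
  qed
  then have copy: "s_copy_no_isolated q n s ?W E (X ` E)"
    unfolding s_copy_no_isolated_def Let_def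
    using X H card sums by (intro conjI exI[of _ f]) (auto simp: the)
  have "card V \<le> n" using card_inj_on_le[OF f] by simp
  then have "s_copy q n s V E (X ` E)"
    using copy by (auto simp: s_copy_def ind)
  moreover have "X ` E \<subseteq> H" using X by auto
  ultimately show ?thesis by (auto simp: contains_s_copy_def)
qed

text \<open>The states \<open>a\<close> and \<open>b\<close> are pairs of a vertex and its threshold; \<open>a\<close> is the parent and \<open>b\<close>
  the child.\<close>

definition link :: "nat \<Rightarrow> nat \<Rightarrow> (nat \<Rightarrow> nat) \<Rightarrow> nat \<times> nat \<Rightarrow> nat \<times> nat \<Rightarrow> bool" where
  "link q n x a b \<longleftrightarrow>
     supp n x = {fst a, fst b} \<and> snd a \<le> x (fst a) \<and> q + 1 \<le> x (fst b) + snd b"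

text \<open>An embedding by states \<open>g\<close>. The second last clause is what allows a further child at any
  vertex: a new \<open>q\<close>-edge has at least the threshold there.\<close>

definition state_copy ::
    "nat \<Rightarrow> nat \<Rightarrow> (nat \<Rightarrow> nat) set \<Rightarrow> 'a set \<Rightarrow> 'a set set \<Rightarrow>
      ('a \<Rightarrow> nat \<times> nat) \<Rightarrow> ('a set \<Rightarrow> nat \<Rightarrow> nat) \<Rightarrow> bool" where
  "state_copy q n H V E g X \<longleftrightarrow> inj_on (\<lambda>v. fst (g v)) V \<and>
    (\<forall>e\<in>E. X e \<in> H \<and> supp n (X e) = (\<lambda>v. fst (g v)) ` e) \<and>
    (\<forall>e\<in>E. \<forall>v\<in>e. q + 1 \<le> X e (fst (g v)) + snd (g v)) \<and>
    (\<forall>e\<in>E. \<forall>e'\<in>E. \<forall>v\<in>e \<inter> e'. e \<noteq> e' \<longrightarrow> q + 1 \<le> X e (fst (g v)) + X e' (fst (g v)))"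

text \<open>The predicate \<open>G\<close> describes the sets of states that may be occupied at an intermediate stage.
  It is a parameter because the construction is run twice: once inside a set of states with many
  links, where any subset will do, and once from the top of a ranking downwards.\<close>

lemma greedy_states:
  assumes "leaf_built V E" "card V \<le> r"
    and start: "G {a0}"
    and states: "\<And>A a. G A \<Longrightarrow> a \<in> A \<Longrightarrow> q + 1 \<le> 2 * snd a"
    and extend: "\<And>A a. G A \<Longrightarrow> finite A \<Longrightarrow> card A < r \<Longrightarrow> a \<in> A \<Longrightarrow>
      \<exists>b x. G (insert b A) \<and> fst b \<notin> fst ` A \<and> x \<in> H \<and> link q n x a b"
  shows "\<exists>g X. G (g ` V) \<and> state_copy q n H V E g X"
  using assms(1,2)
proof (induction rule: leaf_built.induct)
  case (single t)
  show ?case using start by (intro exI[of _ "\<lambda>_. a0"]) (auto simp: state_copy_def)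
next
  case (attach V E p v)
  have fin: "finite V" using attach.hyps leaf_built_finite by auto
  then have cardV: "card V < r" using attach.prems attach.hyps by simp
  then have "card V \<le> r" by simp
  from attach.IH[OF this] obtain g X where G: "G (g ` V)" and copy: "state_copy q n H V E g X"
    by blast
  have g: "G (g ` V)" "inj_on (\<lambda>v. fst (g v)) V"
    and X: "\<And>e. e \<in> E \<Longrightarrow> X e \<in> H \<and> supp n (X e) = (\<lambda>v. fst (g v)) ` e"
    and slack: "\<And>e v. e \<in> E \<Longrightarrow> v \<in> e \<Longrightarrow> q + 1 \<le> X e (fst (g v)) + snd (g v)"
    and sums: "\<And>e e' v. e \<in> E \<Longrightarrow> e' \<in> E \<Longrightarrow> e \<noteq> e' \<Longrightarrow> v \<in> e \<Longrightarrow> v \<in> e' \<Longrightarrow>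
       q + 1 \<le> X e (fst (g v)) + X e' (fst (g v))"
    using G copy by (simp_all add: state_copy_def)
  have "card (g ` V) < r" using card_image_le[OF fin, of g] cardV by simp
  then obtain b x where b: "G (insert b (g ` V))" "fst b \<notin> fst ` g ` V" "x \<in> H"
      "link q n x (g p) b"
    using extend[of "g ` V" "g p"] g(1) fin attach.hyps by auto
  have sub: "e \<subseteq> V" if "e \<in> E" for e using leaf_built_edges attach.hyps that by metis
  have nv: "v \<notin> e" if "e \<in> E" for e using sub that attach.hyps by auto
  have pv: "p \<noteq> v" using attach.hyps by auto
  have new: "{p, v} \<notin> E" using nv by auto
  let ?g = "g(v := b)" and ?X = "X({p, v} := x)"
  have old: "?g w = g w" if "w \<in> V" for w using that attach.hyps by auto
  have "?g ` V = g ` V" using old by (intro image_cong) blast+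
  then have img: "?g ` insert v V = insert b (g ` V)" by (simp only: image_insert fun_upd_same)
  have oldX: "?X e = X e" if "e \<in> E" for e using that new by auto
  have olde: "?g w = g w" if "e \<in> E" "w \<in> e" for e w using that sub old by blast
  have two: "q + 1 \<le> 2 * snd (g p)" using states[OF g(1)] attach.hyps by auto
  have "state_copy q n H (insert v V) (insert {p, v} E) ?g ?X"
    unfolding state_copy_def
  proof (intro conjI ballI impI)
    have "inj_on (\<lambda>w. fst (?g w)) V"
      using g(2) old by (simp add: inj_on_def)
    moreover have "fst (?g v) \<notin> (\<lambda>w. fst (?g w)) ` V" using b(2) old by auto
    ultimately show "inj_on (\<lambda>w. fst (?g w)) (insert v V)"
      using attach.hyps by (simp only: inj_on_insert) simp
  next
    fix e assume e: "e \<in> insert {p, v} E"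
    show "?X e \<in> H"
      using e X oldX b(3) by (cases "e = {p, v}") auto
    show "supp n (?X e) = (\<lambda>w. fst (?g w)) ` e"
    proof (cases "e = {p, v}")
      case True
      then show ?thesis using b(4) pv by (simp add: link_def)
    next
      case False
      then have "e \<in> E" using e by simp
      then show ?thesis using X oldX olde by simp
    qed
  next
    fix e w assume e: "e \<in> insert {p, v} E" "w \<in> e"
    show "q + 1 \<le> ?X e (fst (?g w)) + snd (?g w)"
    proof (cases "e = {p, v}")
      case True
      then show ?thesis using b(4) two pv e(2) by (auto simp: link_def)
    next
      case False
      then have "e \<in> E" using e by simp
      then show ?thesis using slack[OF _ e(2)] oldX olde[OF _ e(2)] by simp
    qed
  next
    have new_old: "q + 1 \<le> x (fst (?g w)) + X e (fst (?g w))"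
      if "e \<in> E" "w \<in> e" "w \<in> {p, v}" for e w
    proof -
      have "w = p" using nv that by auto
      then show ?thesis using slack[OF that(1,2)] b(4) pv by (simp add: link_def)
    qed
    fix e e' w assume e: "e \<in> insert {p, v} E" "e' \<in> insert {p, v} E" "w \<in> e \<inter> e'" "e \<noteq> e'"
    consider "e = {p, v}" "e' \<in> E" | "e' = {p, v}" "e \<in> E" | "e \<in> E" "e' \<in> E"
      using e by blast
    then show "q + 1 \<le> ?X e (fst (?g w)) + ?X e' (fst (?g w))"
    proof cases
      case 1
      then show ?thesis using new_old[of e' w] e oldX by auto
    next
      case 2
      then show ?thesis using new_old[of e w] e oldX by (auto simp: add.commute)
    next
      case 3
      then show ?thesis using sums[OF 3 e(4)] e(3) oldX olde[OF 3(1)] by simp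
    qed
  qed
  moreover have "G (?g ` insert v V)" using b(1) img by metis
  ultimately show ?case by blast
qed

lemma greedy_copy:
  assumes "is_tree V E" "card V \<le> r" "H \<subseteq> q_edges q n"
    and start: "G {a0}"
    and states: "\<And>A a. G A \<Longrightarrow> a \<in> A \<Longrightarrow> fst a \<in> {1..n} \<and> q + 1 \<le> 2 * snd a"
    and extend: "\<And>A a. G A \<Longrightarrow> finite A \<Longrightarrow> card A < r \<Longrightarrow> a \<in> A \<Longrightarrow>
      \<exists>b x. G (insert b A) \<and> fst b \<notin> fst ` A \<and> x \<in> H \<and> link q n x a b"
  shows "contains_s_copy q n (q + 1) V E H"
proof -
  have "\<exists>g X. G (g ` V) \<and> state_copy q n H V E g X"
    using states
    by (intro greedy_states[OF tree_leaf_built[OF assms(1)] assms(2), where G = G, OF start])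
      (blast, rule extend)
  then obtain g X where g: "G (g ` V)" and copy: "state_copy q n H V E g X"
    by blast
  show ?thesis
  proof (rule contains_s_copyI[where f = "\<lambda>v. fst (g v)" and X = X])
    show "simple_graph V E" using assms(1) by (simp add: is_tree_def)
    show "(\<lambda>v. fst (g v)) ` V \<subseteq> {1..n}" using states[OF g] by blast
  qed (use assms(3) copy in \<open>auto simp: state_copy_def\<close>)
qed

section \<open>Orders in which every element is deficient\<close>

text \<open>As for degenerate graphs: remove an element that is bad for the set of those still present,
  rank it lowest among them, and repeat.\<close>

lemma degeneracy_order:
  assumes "finite S" "\<And>A. A \<subseteq> S \<Longrightarrow> A \<noteq> {} \<Longrightarrow> \<exists>a\<in>A. bad a A"
  shows "\<exists>\<tau>::'b \<Rightarrow> nat. inj_on \<tau> S \<and> (\<forall>a\<in>S. bad a {b \<in> S. \<tau> a \<le> \<tau> b})"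
  using assms
proof (induction "card S" arbitrary: S)
  case 0
  then show ?case by auto
next
  case (Suc k)
  then have "S \<noteq> {}" by auto
  then obtain a where a: "a \<in> S" "bad a S" using Suc.prems(2)[of S] by auto
  let ?S = "S - {a}"
  have "\<exists>\<tau>::'b \<Rightarrow> nat. inj_on \<tau> ?S \<and> (\<forall>c\<in>?S. bad c {b \<in> ?S. \<tau> c \<le> \<tau> b})"
  proof (rule Suc.hyps(1))
    show "k = card ?S" using Suc a by simp
    show "finite ?S" using Suc by simp
    show "\<exists>a\<in>A. bad a A" if "A \<subseteq> ?S" "A \<noteq> {}" for A using Suc.prems(2)[of A] that by auto
  qed
  then obtain \<tau> :: "'b \<Rightarrow> nat" where \<tau>: "inj_on \<tau> ?S" "\<And>c. c \<in> ?S \<Longrightarrow> bad c {b \<in> ?S. \<tau> c \<le> \<tau> b}"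
    by auto
  define \<sigma> where "\<sigma> b = (if b = a then 0 else Suc (\<tau> b))" for b
  have "inj_on \<sigma> S" using \<tau>(1) by (auto simp: inj_on_def \<sigma>_def)
  moreover have "bad c {b \<in> S. \<sigma> c \<le> \<sigma> b}" if "c \<in> S" for c
  proof (cases "c = a")
    case True
    then have "{b \<in> S. \<sigma> c \<le> \<sigma> b} = S" by (auto simp: \<sigma>_def)
    then show ?thesis using True a by simp
  next
    case False
    then have "{b \<in> S. \<sigma> c \<le> \<sigma> b} = {b \<in> ?S. \<tau> c \<le> \<tau> b}" by (auto simp: \<sigma>_def)
    then show ?thesis using False \<tau>(2)[of c] that by simp
  qed
  ultimately show ?case by auto
qed


section \<open>Complementary values\<close>

text \<open>For a set \<open>P\<close> that is disjoint from its image under an involution, the elements outside both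
  measure exactly how far \<open>P\<close> is from half of the ground set. This gives the upper bound, its
  improvement when \<open>P\<close> misses an orbit, and the size of the universal tree.\<close>

lemma involution_card:
  assumes "finite F" "P \<subseteq> F" and f: "\<And>x. x \<in> F \<Longrightarrow> f x \<in> F \<and> f (f x) = x"
    and free: "\<And>x. x \<in> P \<Longrightarrow> f x \<notin> P"
  shows "2 * card P + card (F - P - f ` P) = card F"
proof -
  have fin: "finite P" using assms(1,2) finite_subset by blast
  have sub: "f ` P \<subseteq> F" using f assms(2) by auto
  have "inj_on f F" by (rule inj_on_inverseI[of _ f]) (use f in auto)
  then have "card (f ` P) = card P" using assms(2) card_image inj_on_subset by blast
  moreover have "card (P \<union> f ` P) = card P + card (f ` P)"
    using fin free by (intro card_Un_disjoint) auto
  moreover have "card (F - (P \<union> f ` P)) = card F - card (P \<union> f ` P)"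
    using fin assms(2) sub by (intro card_Diff_subset) auto
  moreover have "card (P \<union> f ` P) \<le> card F"
    using assms(1,2) sub by (intro card_mono) auto
  moreover have "F - (P \<union> f ` P) = F - P - f ` P" by auto
  ultimately show ?thesis by simp
qed

definition fibre :: "nat \<Rightarrow> (nat \<Rightarrow> nat) set \<Rightarrow> nat set \<Rightarrow> (nat \<Rightarrow> nat) set" where
  "fibre n H e = {x \<in> H. supp n x = e}"

text \<open>The complement of a \<open>q\<close>-edge.\<close>

definition flip :: "nat \<Rightarrow> nat \<Rightarrow> (nat \<Rightarrow> nat) \<Rightarrow> nat \<Rightarrow> nat" where
  "flip q n x = (\<lambda>i\<in>{1..n}. if x i = 0 then 0 else q + 1 - x i)"

lemma q_edges_le: "x \<in> q_edges q n \<Longrightarrow> i \<in> {1..n} \<Longrightarrow> x i \<le> q"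
  by (fastforce simp: q_edges_def PiE_iff)

lemma q_edges_supp: 
  assumes "x \<in> q_edges q n" "i \<in> supp n x" 
  shows "i \<in> {1..n}" "1 \<le> x i" "x i \<le> q"
  using assms q_edges_le[OF assms(1), of i] by (auto simp: supp_def)

lemma q_edges_obtain_supp:
  assumes "x \<in> q_edges q n"
  obtains u v where "supp n x = {u, v}" "u \<noteq> v"
  using assms by (auto simp: q_edges_def card_2_iff)

lemma flip_q_edges:
  assumes "x \<in> q_edges q n"
  shows "flip q n x \<in> q_edges q n" "supp n (flip q n x) = supp n x" "flip q n (flip q n x) = x"
    "i \<in> supp n x \<Longrightarrow> flip q n x i = q + 1 - x i"
proof -
  have le: "x i \<le> q" if "i \<in> {1..n}" for i using assms that q_edges_le by blast
  have ext: "x \<in> extensional {1..n}" using assms by (auto simp: q_edges_def PiE_def)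
  show supp: "supp n (flip q n x) = supp n x"
  proof -
    have "flip q n x i \<noteq> 0 \<longleftrightarrow> x i \<noteq> 0" if "i \<in> {1..n}" for i
      using le[OF that] that by (simp add: flip_def)
    then show ?thesis unfolding supp_def by blast
  qed
  show "flip q n x \<in> q_edges q n"
    using assms supp by (auto simp: q_edges_def flip_def PiE_iff)
  show "flip q n (flip q n x) = x"
  proof (rule extensionalityI[OF _ ext])
    fix i assume i: "i \<in> {1..n}"
    show "flip q n (flip q n x) i = x i" using le[OF i] i by (simp add: flip_def)
  qed (simp add: flip_def)
  show "i \<in> supp n x \<Longrightarrow> flip q n x i = q + 1 - x i"
    by (simp add: supp_def flip_def)
qed

lemma fibre_values_bij:
  assumes "u \<in> {1..n}" "v \<in> {1..n}" "u \<noteq> v"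
  shows "bij_betw (\<lambda>x. (x u, x v)) (fibre n (q_edges q n) {u, v}) ({1..q} \<times> {1..q})"
proof (rule bij_betw_byWitness[where f' = "\<lambda>(a, b). \<lambda>i\<in>{1..n}. if i = u then a else if i = v then b else 0"])
  let ?g = "\<lambda>(a, b). \<lambda>i\<in>{1..n}. if i = u then a else if i = v then b else (0::nat)"
  show "\<forall>x\<in>fibre n (q_edges q n) {u, v}. ?g (x u, x v) = x"
  proof
    fix x assume "x \<in> fibre n (q_edges q n) {u, v}"
    then have x: "x \<in> extensional {1..n}" "supp n x = {u, v}"
      by (auto simp: fibre_def q_edges_def PiE_def)
    then have zero: "x i = 0" if "i \<in> {1..n}" "i \<noteq> u" "i \<noteq> v" for i
      using that unfolding supp_def by blast
    show "?g (x u, x v) = x"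
      by (rule extensionalityI[OF _ x(1)]) (use zero in auto)
  qed
  show "\<forall>y\<in>{1..q} \<times> {1..q}. (\<lambda>x. (x u, x v)) (?g y) = y"
    using assms by auto
  show "(\<lambda>x. (x u, x v)) ` fibre n (q_edges q n) {u, v} \<subseteq> {1..q} \<times> {1..q}"
  proof (rule image_subsetI)
    fix x assume "x \<in> fibre n (q_edges q n) {u, v}"
    then have "x \<in> q_edges q n" "u \<in> supp n x" "v \<in> supp n x" by (auto simp: fibre_def)
    then show "(x u, x v) \<in> {1..q} \<times> {1..q}" using q_edges_supp by simp
  qed
  show "?g ` ({1..q} \<times> {1..q}) \<subseteq> fibre n (q_edges q n) {u, v}"
  proof (rule image_subsetI)
    fix y assume "y \<in> {1..q} \<times> {1..q}"
    then obtain a b where ab: "y = (a, b)" "a \<in> {1..q}" "b \<in> {1..q}" by blast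
    have "supp n (?g (a, b)) = {u, v}" using ab assms by (auto simp: supp_def)
    then show "?g y \<in> fibre n (q_edges q n) {u, v}"
      using ab assms by (auto simp: fibre_def q_edges_def PiE_iff)
  qed
qed

lemma finite_q_edges: "finite (q_edges q n)"
  unfolding q_edges_def by (rule finite_subset[OF _ finite_PiE[of "{1..n}" "\<lambda>_. {0..q}"]]) auto

definition pairs :: "nat \<Rightarrow> nat set set" where
  "pairs n = {e. e \<subseteq> {1..n} \<and> card e = 2}"

lemma finite_pairs: "finite (pairs n)"
  unfolding pairs_def by (rule finite_subset[of _ "Pow {1..n}"]) auto

lemma card_pairs: "card (pairs n) = n choose 2"
  using n_subsets[of "{1..n}" 2] by (simp add: pairs_def)

lemma pairsE:
  assumes "e \<in> pairs n"
  obtains u v where "e = {u, v}" "u \<noteq> v" "u \<in> {1..n}" "v \<in> {1..n}"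
  using assms by (auto simp: pairs_def card_2_iff)

lemma supp_in_pairs: "x \<in> q_edges q n \<Longrightarrow> supp n x \<in> pairs n"
  by (auto simp: q_edges_def pairs_def supp_def)

lemma card_fibre_q_edges: "e \<in> pairs n \<Longrightarrow> card (fibre n (q_edges q n) e) = q\<^sup>2"
  by (elim pairsE) (simp add: bij_betw_same_card[OF fibre_values_bij] power2_eq_square)

lemma card_fibre_le: "card (fibre n (q_edges q n) e) \<le> q\<^sup>2"
proof (cases "e \<in> pairs n")
  case False
  then have "fibre n (q_edges q n) e = {}" using supp_in_pairs by (auto simp: fibre_def)
  then show ?thesis by simp
qed (simp add: card_fibre_q_edges)

lemma card_eq_sum_fibres:
  assumes "H \<subseteq> q_edges q n"
  shows "card H = (\<Sum>e\<in>pairs n. card (fibre n H e))"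
proof -
  have fin: "finite H" using assms finite_q_edges finite_subset by blast
  have "H = (\<Union>e\<in>pairs n. fibre n H e)"
    using assms supp_in_pairs by (fastforce simp: fibre_def)
  also have "card \<dots> = (\<Sum>e\<in>pairs n. card (fibre n H e))"
    using fin by (intro card_UN_disjoint finite_pairs) (auto simp: fibre_def)
  finally show ?thesis .
qed

lemma flip_free_fibre:
  assumes "H \<subseteq> q_edges q n" "e \<in> pairs n" "\<And>x. x \<in> H \<Longrightarrow> flip q n x \<notin> H"
  shows "2 * card (fibre n H e)
    + card (fibre n (q_edges q n) e - fibre n H e - flip q n ` fibre n H e) = q\<^sup>2"
proof -
  have "finite (fibre n (q_edges q n) e)"
    using finite_q_edges by (simp add: fibre_def)
  then have "2 * card (fibre n H e)
    + card (fibre n (q_edges q n) e - fibre n H e - flip q n ` fibre n H e)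
      = card (fibre n (q_edges q n) e)"
    using assms(1,3) flip_q_edges[of _ q n] by (intro involution_card) (auto simp: fibre_def)
  then show ?thesis using card_fibre_q_edges[OF assms(2)] by simp
qed

section \<open>The size of the universal tree\<close>

lemma universal_q_tree_mem:
  assumes x: "x \<in> q_edges q n" and supp: "supp n x = {i, j}" and "i < j"
  shows "x \<in> universal_q_tree q n \<longleftrightarrow> x i + x j \<le> q \<or> x i < x j \<and> x i + x j = q + 1"
proof -
  have ij: "i \<in> {1..n}" "j \<in> {1..n}" using q_edges_supp[OF x] supp by auto
  have "(\<Sum>k=1..n. x k) = (\<Sum>k\<in>{i, j}. x k)"
  proof (rule sum.mono_neutral_right)
    show "\<forall>k\<in>{1..n} - {i, j}. x k = 0" using supp unfolding supp_def by blast
  qed (use ij in auto)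
  then have sum: "(\<Sum>k=1..n. x k) = x i + x j" using \<open>i < j\<close> by simp
  have "x \<in> (\<Union>(i, j)\<in>{(i, j). 1 \<le> i \<and> i < j \<and> j \<le> n}. U_eq q n i j)
      \<longleftrightarrow> x i < x j \<and> x i + x j = q + 1" (is "?l \<longleftrightarrow> ?r")
  proof
    assume ?l
    then obtain a b where ab: "a < b" "{a, b} = {i, j}" "x a < x b" "x a + x b = q + 1"
      using supp by (auto simp: U_eq_def)
    then have "a = i \<and> b = j" using \<open>i < j\<close> by (auto simp: doubleton_eq_iff)
    then show ?r using ab by auto
  next
    assume ?r
    then have "x \<in> U_eq q n i j" using x supp by (simp add: U_eq_def)
    then show ?l using ij \<open>i < j\<close> by auto
  qed
  moreover have "x \<in> U_less q n \<longleftrightarrow> x i + x j \<le> q" using x sum by (auto simp: U_less_def)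
  ultimately show ?thesis unfolding universal_q_tree_def Un_iff by blast
qed

text \<open>Complementation turns a value sum \<open>\<sigma>\<close> into \<open>2 * (q + 1) - \<sigma>\<close>, and it reverses the comparison
  of the two values. So on each pair the universal tree contains exactly one of \<open>x\<close> and its
  complement, except for the \<open>q\<close>-edge with both values \<open>(q + 1) / 2\<close>, which exists for odd \<open>q\<close>
  and is its own complement.\<close>

lemma card_universal_q_tree: "card (universal_q_tree q n) = (q\<^sup>2 div 2) * (n choose 2)"
proof -
  let ?U = "universal_q_tree q n"
  have sub: "?U \<subseteq> q_edges q n"
    by (auto simp: universal_q_tree_def U_less_def U_eq_def)
  have ordered: "\<exists>i j. supp n x = {i, j} \<and> i < j" if "x \<in> q_edges q n" for x
    using q_edges_obtain_supp[OF that] by (metis insert_commute linorder_neqE_nat)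
  have free: "flip q n x \<notin> ?U" if "x \<in> ?U" for x
  proof -
    have x: "x \<in> q_edges q n" using that sub by auto
    then obtain i j where ij: "supp n x = {i, j}" "i < j" using ordered by blast
    have "flip q n x i = q + 1 - x i" "flip q n x j = q + 1 - x j"
      using flip_q_edges(4)[OF x] ij by auto
    moreover have "x i \<le> q" "x j \<le> q" using q_edges_supp[OF x] ij by auto
    ultimately show ?thesis
      using that universal_q_tree_mem[OF x ij]
        universal_q_tree_mem[OF flip_q_edges(1)[OF x], of i j] flip_q_edges(2)[OF x] ij
      by auto
  qed
  have "card (fibre n ?U e) = q\<^sup>2 div 2" if e: "e \<in> pairs n" for e
  proof -
    let ?Z = "fibre n (q_edges q n) e - fibre n ?U e - flip q n ` fibre n ?U e"
    obtain i j where ij: "e = {i, j}" "i < j" "i \<in> {1..n}" "j \<in> {1..n}"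
      using e by (elim pairsE) (metis insert_commute linorder_neqE_nat)
    have central: "2 * x i = q + 1 \<and> 2 * x j = q + 1" if "x \<in> ?Z" for x
    proof -
      have x: "x \<in> q_edges q n" "supp n x = {i, j}" "x \<notin> ?U"
        using that ij by (auto simp: fibre_def)
      note fl = flip_q_edges[OF x(1)]
      have "flip q n x \<notin> ?U"
      proof
        assume "flip q n x \<in> ?U"
        then have "flip q n x \<in> fibre n ?U e" using fl(2) x(2) ij by (simp add: fibre_def)
        then have "flip q n (flip q n x) \<in> flip q n ` fibre n ?U e" by (rule imageI)
        then show False using that fl(3) by simp
      qed
      moreover have "flip q n x i = q + 1 - x i" "flip q n x j = q + 1 - x j"
        using fl(4) x(2) by auto
      moreover have "x i \<le> q" "x j \<le> q" using q_edges_supp[OF x(1)] x(2) by auto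
      ultimately show ?thesis
        using x(3) universal_q_tree_mem[OF x(1,2) ij(2)]
          universal_q_tree_mem[OF fl(1), of i j] fl(2) x(2) ij(2)
        by auto
    qed
    have "inj_on (\<lambda>x. (x i, x j)) ?Z"
      using bij_betw_imp_inj_on[OF fibre_values_bij[of i n j q]] ij
      by (auto intro: inj_on_subset)
    moreover have "(\<lambda>x. (x i, x j)) ` ?Z \<subseteq> {((q + 1) div 2, (q + 1) div 2)}"
    proof (rule image_subsetI)
      fix x assume "x \<in> ?Z"
      from central[OF this] have "x i = (q + 1) div 2" "x j = (q + 1) div 2" by linarith+
      then show "(x i, x j) \<in> {((q + 1) div 2, (q + 1) div 2)}" by simp
    qed
    ultimately have "card ?Z \<le> card {((q + 1) div 2, (q + 1) div 2)}"
      by (rule card_inj_on_le) simp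
    then have "card ?Z \<le> 1" by simp
    then show ?thesis using flip_free_fibre[OF sub e free] by linarith
  qed
  then show ?thesis
    unfolding card_eq_sum_fibres[OF sub] by (simp add: card_pairs)
qed

section \<open>Double counting\<close>

lemma card_supersets_le:
  assumes "e \<in> pairs n"
  shows "card {S. S \<subseteq> {1..n} \<and> card S = r \<and> e \<subseteq> S} \<le> (n - 2) choose (r - 2)"
proof -
  have e: "e \<subseteq> {1..n}" "card e = 2" "finite e"
    using assms by (auto simp: pairs_def intro: finite_subset)
  let ?T = "{S. S \<subseteq> {1..n} - e \<and> card S = r - 2}"
  have "card {S. S \<subseteq> {1..n} \<and> card S = r \<and> e \<subseteq> S} \<le> card ?T"
  proof (rule card_inj_on_le[where f = "\<lambda>S. S - e"])
    show "inj_on (\<lambda>S. S - e) {S. S \<subseteq> {1..n} \<and> card S = r \<and> e \<subseteq> S}"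
      by (auto simp: inj_on_def)
    show "(\<lambda>S. S - e) ` {S. S \<subseteq> {1..n} \<and> card S = r \<and> e \<subseteq> S} \<subseteq> ?T"
      using e by (auto simp: card_Diff_subset)
    show "finite ?T" by (rule finite_subset[of _ "Pow {1..n}"]) auto
  qed
  also have "card ?T = card ({1..n} - e) choose (r - 2)"
    by (rule n_subsets) simp
  also have "card ({1..n} - e) = n - 2" using e by (simp add: card_Diff_subset)
  finally show ?thesis .
qed

text \<open>Count the incidences between the sets of size \<open>r\<close> and the pairs of \<open>B\<close> that they contain.\<close>

lemma hitting_pairs_bound:
  assumes "2 \<le> r" "r \<le> n" "B \<subseteq> pairs n"
    and hit: "\<And>S. S \<subseteq> {1..n} \<Longrightarrow> card S = r \<Longrightarrow> \<exists>e\<in>B. e \<subseteq> S"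
  shows "n choose 2 \<le> card B * (r choose 2)"
proof -
  let ?S = "{S. S \<subseteq> {1..n} \<and> card S = r}" and ?c = "(n - 2) choose (r - 2)"
  have finS: "finite ?S" by (rule finite_subset[of _ "Pow {1..n}"]) auto
  have finB: "finite B" using assms(3) finite_pairs finite_subset by blast
  have "n choose r = card ?S" using n_subsets[of "{1..n}" r] by simp
  also have "\<dots> \<le> (\<Sum>S\<in>?S. card {e \<in> B. e \<subseteq> S})"
  proof -
    have "1 \<le> card {e \<in> B. e \<subseteq> S}" if S: "S \<in> ?S" for S
      using hit[of S] S finB by (auto simp: Suc_le_eq card_gt_0_iff)
    then have "(\<Sum>S\<in>?S. 1) \<le> (\<Sum>S\<in>?S. card {e \<in> B. e \<subseteq> S})" by (intro sum_mono)
    then show ?thesis by simp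
  qed
  also have "\<dots> = (\<Sum>e\<in>B. card {S \<in> ?S. e \<subseteq> S})"
    using sum_multicount_gen[OF finS finB, of "\<lambda>S e. e \<subseteq> S" "\<lambda>e. card {S \<in> ?S. e \<subseteq> S}"] by simp
  also have "\<dots> \<le> (\<Sum>e\<in>B. ?c)"
    using card_supersets_le[of _ n r] assms(3) by (intro sum_mono) auto
  finally have "n choose r \<le> card B * ?c" by simp
  then have "(n choose 2) * ?c \<le> (card B * ?c) * (r choose 2)"
    using choose_mult[OF assms(1,2)] mult_le_mono1 by metis
  then have "(n choose 2) * ?c \<le> (card B * (r choose 2)) * ?c" by (simp add: mult_ac)
  moreover have "0 < ?c" using assms(1,2) by (simp add: zero_less_binomial)
  ultimately show ?thesis by simp
qed


section \<open>Ranked q-graphs\<close>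

definition states :: "nat \<Rightarrow> nat \<Rightarrow> (nat \<times> nat) set" where
  "states q n = {1..n} \<times> {t. q + 1 \<le> 2 * t \<and> t \<le> q}"

lemma states_bound: "finite (states q n)" "card (states q n) \<le> n * q"
proof -
  have "states q n \<subseteq> {1..n} \<times> {1..q}" by (auto simp: states_def)
  then show "finite (states q n)" "card (states q n) \<le> n * q"
    using finite_subset[of "states q n" "{1..n} \<times> {1..q}"]
      card_mono[of "{1..n} \<times> {1..q}" "states q n"] by (auto simp: card_cartesian_product)
qed

definition ranked :: "nat \<Rightarrow> nat \<Rightarrow> (nat \<times> nat \<Rightarrow> nat) \<Rightarrow> (nat \<Rightarrow> nat) set \<Rightarrow> bool" where
  "ranked q n \<tau> H \<longleftrightarrow> H \<subseteq> q_edges q n \<and> inj_on \<tau> (states q n) \<and>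
     (\<forall>x\<in>H. \<forall>a\<in>states q n. \<forall>b\<in>states q n. link q n x a b \<longrightarrow> \<tau> b < \<tau> a)"

lemma rankedD:
  assumes "ranked q n \<tau> H" "x \<in> H" "supp n x = {u, v}"
    and "q + 1 \<le> 2 * t" "t \<le> x u" "q + 1 \<le> 2 * s" "s \<le> q" "q + 1 \<le> x v + s"
  shows "\<tau> (v, s) < \<tau> (u, t)"
proof -
  have x: "x \<in> q_edges q n" using assms(1,2) by (auto simp: ranked_def)
  have "u \<in> {1..n}" "v \<in> {1..n}" "x u \<le> q" using q_edges_supp[OF x] assms(3) by auto
  then have "(u, t) \<in> states q n" "(v, s) \<in> states q n" using assms by (auto simp: states_def)
  moreover have "link q n x (u, t) (v, s)" using assms by (simp add: link_def)
  ultimately show ?thesis using assms(1,2) by (auto simp: ranked_def)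
qed

text \<open>One of \<open>x\<close> and its complement has value at least \<open>(q + 1) / 2\<close> at \<open>u\<close>; call it \<open>y\<close>. If also
  \<open>y v \<ge> (q + 1) / 2\<close>, then \<open>y\<close> alone links \<open>(u, y u)\<close> and \<open>(v, y v)\<close> in both directions.
  Otherwise \<open>y\<close> links \<open>(u, y u)\<close> to \<open>(v, q + 1 - y v)\<close>, and the complement of \<open>y\<close> provides the
  reverse link.\<close>

lemma ranked_flip_free:
  assumes ranked: "ranked q n \<tau> H" and "x \<in> H"
  shows "flip q n x \<notin> H"
proof
  assume flip: "flip q n x \<in> H"
  have sub: "H \<subseteq> q_edges q n" using ranked by (simp add: ranked_def)
  have contra: False
    if y: "y \<in> H" "flip q n y \<in> H" and uv: "supp n y = {u, v}" and large: "q + 1 \<le> 2 * y u"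
    for y u v
  proof -
    have yq: "y \<in> q_edges q n" using y(1) sub by auto
    have vals: "1 \<le> y u" "y u \<le> q" "1 \<le> y v" "y v \<le> q" using q_edges_supp[OF yq] uv by auto
    have vu: "supp n y = {v, u}" using uv by auto
    show False
    proof (cases "q + 1 \<le> 2 * y v")
      case True
      then show False
        using rankedD[OF ranked y(1) uv, of "y u" "y v"]
          rankedD[OF ranked y(1) vu, of "y v" "y u"] large vals by auto
    next
      case False
      let ?s = "q + 1 - y v"
      have "supp n (flip q n y) = {v, u}" "flip q n y v = ?s" "flip q n y u = q + 1 - y u"
        using flip_q_edges(2,4)[OF yq] vu by auto
      moreover have "q + 1 \<le> 2 * ?s" "?s \<le> q" "q + 1 \<le> y v + ?s" "q + 1 \<le> (q + 1 - y u) + y u"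
        using False vals by linarith+
      ultimately show False
        using rankedD[OF ranked y(1) uv, of "y u" ?s]
          rankedD[OF ranked y(2), of v u ?s "y u"] large vals(2) by simp
    qed
  qed
  have x: "x \<in> q_edges q n" using sub assms(2) by auto
  obtain u v where uv: "supp n x = {u, v}" using q_edges_obtain_supp[OF x] by blast
  show False
  proof (cases "q + 1 \<le> 2 * x u")
    case True
    then show False using contra[OF assms(2) flip uv] by simp
  next
    case False
    moreover have "flip q n x u = q + 1 - x u" using flip_q_edges(4)[OF x] uv by simp
    ultimately have "q + 1 \<le> 2 * flip q n x u" by simp
    then show False
      using contra[OF flip, of u v] flip_q_edges(2,3)[OF x] uv assms(2) by simp
  qed
qed

text \<open>The least value that exceeds its complement.\<close>

definition heavy :: "nat \<Rightarrow> nat" where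
  "heavy q = (q + 1) div 2 + 1"

lemma heavy_bounds: "2 \<le> q \<Longrightarrow> heavy q \<le> q" "q + 2 \<le> 2 * heavy q"
  by (auto simp: heavy_def)

definition balanced :: "nat \<Rightarrow> nat \<Rightarrow> (nat \<Rightarrow> nat) set \<Rightarrow> nat \<Rightarrow> nat \<Rightarrow> bool" where
  "balanced q n H u v \<longleftrightarrow> (\<exists>x\<in>H. supp n x = {u, v} \<and> x u = heavy q \<and> x v = q + 1 - heavy q)"

definition unbalanced_pairs :: "nat \<Rightarrow> nat \<Rightarrow> (nat \<Rightarrow> nat) set \<Rightarrow> nat set set" where
  "unbalanced_pairs q n H = {e \<in> pairs n. \<forall>u v. e = {u, v} \<longrightarrow> \<not> balanced q n H u v}"

text \<open>The two balanced \<open>q\<close>-edges on a pair are distinct complements of each other. If both are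
  missing, the \<open>q\<close>-edges present and their complements cover at most \<open>q\<^sup>2 - 2\<close> of the \<open>q\<^sup>2\<close>
  possible ones.\<close>

lemma unbalanced_fibre:
  assumes "2 \<le> q" "ranked q n \<tau> H" "e \<in> unbalanced_pairs q n H"
  shows "card (fibre n H e) + 1 \<le> q\<^sup>2 div 2"
proof -
  let ?F = "fibre n (q_edges q n) e"
  have sub: "H \<subseteq> q_edges q n" using assms(2) by (simp add: ranked_def)
  have e: "e \<in> pairs n" using assms(3) by (simp add: unbalanced_pairs_def)
  then obtain u v where uv: "e = {u, v}" "u \<noteq> v" "u \<in> {1..n}" "v \<in> {1..n}" by (rule pairsE)
  have "(heavy q, q + 1 - heavy q) \<in> {1..q} \<times> {1..q}" using heavy_bounds[of q] assms(1) by auto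
  then have "(heavy q, q + 1 - heavy q) \<in> (\<lambda>x. (x u, x v)) ` ?F"
    using bij_betw_imp_surj_on[OF fibre_values_bij[OF uv(3,4,2), of q]] uv(1) by simp
  then obtain z where z: "z \<in> ?F" "z u = heavy q" "z v = q + 1 - heavy q" by auto
  then have zq: "z \<in> q_edges q n" "supp n z = {u, v}" using uv by (auto simp: fibre_def)
  note fl = flip_q_edges[OF zq(1)]
  have fz: "flip q n z \<in> ?F" "flip q n z u = q + 1 - heavy q" "flip q n z v = heavy q"
    using fl zq(2) uv(1) z(2,3) heavy_bounds[of q] assms(1) by (auto simp: fibre_def)
  have "\<not> balanced q n H u v" "\<not> balanced q n H v u"
    using assms(3) uv(1) by (auto simp: unbalanced_pairs_def insert_commute)
  then have nH: "z \<notin> H" "flip q n z \<notin> H"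
    using z fz zq(2) fl(2) by (auto simp: balanced_def insert_commute)
  have inj: "x = y" if "flip q n x = flip q n y" "x \<in> q_edges q n" "y \<in> q_edges q n" for x y
    using flip_q_edges(3) that by metis
  have "z \<notin> flip q n ` fibre n H e"
    using nH(2) sub flip_q_edges(3) by (auto simp: fibre_def)
  moreover have "flip q n z \<notin> flip q n ` fibre n H e"
    using nH(1) sub inj zq(1) by (auto simp: fibre_def)
  ultimately have "{z, flip q n z} \<subseteq> ?F - fibre n H e - flip q n ` fibre n H e"
    using z(1) fz(1) nH by (auto simp: fibre_def)
  moreover have "finite ?F" using finite_q_edges by (simp add: fibre_def)
  ultimately have "card {z, flip q n z} \<le> card (?F - fibre n H e - flip q n ` fibre n H e)"
    by (intro card_mono) auto
  moreover have "z \<noteq> flip q n z" using z(2) fz(2) heavy_bounds(2)[of q] by auto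
  ultimately have "2 \<le> card (?F - fibre n H e - flip q n ` fibre n H e)" by simp
  then show ?thesis
    using flip_free_fibre[OF sub e ranked_flip_free[OF assms(2)]] by linarith
qed

lemma ranked_card:
  assumes "2 \<le> q" "ranked q n \<tau> H"
  shows "card H + card (unbalanced_pairs q n H) \<le> (q\<^sup>2 div 2) * (n choose 2)"
proof -
  let ?B = "unbalanced_pairs q n H"
  have sub: "H \<subseteq> q_edges q n" using assms(2) by (simp add: ranked_def)
  have B: "?B \<subseteq> pairs n" by (auto simp: unbalanced_pairs_def)
  have each: "card (fibre n H e) + (if e \<in> ?B then 1 else 0) \<le> q\<^sup>2 div 2" if "e \<in> pairs n" for e
    using unbalanced_fibre[OF assms] flip_free_fibre[OF sub that ranked_flip_free[OF assms(2)]]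
    by auto
  have "card ?B = (\<Sum>e\<in>pairs n. if e \<in> ?B then 1 else 0)"
    using B by (simp add: sum.If_cases finite_pairs Int_absorb1)
  then have "card H + card ?B = (\<Sum>e\<in>pairs n. card (fibre n H e) + (if e \<in> ?B then 1 else 0))"
    by (simp add: card_eq_sum_fibres[OF sub] sum.distrib)
  also have "\<dots> \<le> (\<Sum>e\<in>pairs n. q\<^sup>2 div 2)" using each by (intro sum_mono)
  finally show ?thesis by (simp add: card_pairs mult.commute)
qed

lemma obtain_max_image:
  fixes f :: "'b \<Rightarrow> nat"
  assumes "finite A" "A \<noteq> {}"
  obtains a where "a \<in> A" "\<And>b. b \<in> A \<Longrightarrow> f b \<le> f a"
proof -
  have "Max (f ` A) \<in> f ` A" using assms by simp
  then obtain a where a: "Max (f ` A) = f a" "a \<in> A" by (rule imageE)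
  have "f b \<le> f a" if "b \<in> A" for b
    using that assms(1) unfolding a(1)[symmetric] by simp
  then show thesis using that a(2) by blast
qed

text \<open>All states have threshold \<open>heavy q\<close>. A balanced \<open>q\<close>-edge links its heavy end to its light end,
  so in a ranked \<open>q\<close>-graph the heavy end has the higher rank. When the vertices of \<open>S\<close> are used
  in the order of decreasing rank, a new vertex lies below all occupied ones and hence can become
  a child of any of them.\<close>

lemma balanced_clique_copy:
  assumes "is_tree V E" "card V \<le> r" "2 \<le> q" "ranked q n \<tau> H"
    and S: "S \<subseteq> {1..n}" "card S = r" "1 \<le> r"
    and clique: "\<And>e. e \<in> unbalanced_pairs q n H \<Longrightarrow> \<not> e \<subseteq> S"
  shows "contains_s_copy q n (q + 1) V E H"
proof -
  let ?t = "heavy q"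
  have sub: "H \<subseteq> q_edges q n" using assms(4) by (simp add: ranked_def)
  have finS: "finite S" using S(1) finite_subset by blast
  have t: "q + 1 \<le> 2 * ?t" "?t \<le> q" using heavy_bounds[of q] assms(3) by auto
  have inj: "w = w'" if "\<tau> (w, ?t) = \<tau> (w', ?t)" "w \<in> S" "w' \<in> S" for w w'
  proof -
    have "inj_on \<tau> (states q n)" "(w, ?t) \<in> states q n" "(w', ?t) \<in> states q n"
      using assms(4) S(1) t that by (auto simp: ranked_def states_def)
    then show ?thesis using that(1) by (auto dest: inj_onD)
  qed
  define G where "G A \<longleftrightarrow> A \<subseteq> S \<times> {?t} \<and>
    (\<forall>w\<in>S - fst ` A. \<forall>a\<in>A. \<tau> (w, ?t) < \<tau> a)" for A
  have "S \<noteq> {}" using S by auto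
  then obtain w0 where w0: "w0 \<in> S" "\<And>w. w \<in> S \<Longrightarrow> \<tau> (w, ?t) \<le> \<tau> (w0, ?t)"
    using obtain_max_image[OF finS, of "\<lambda>w. \<tau> (w, ?t)"] by blast
  show ?thesis
  proof (rule greedy_copy[OF assms(1,2) sub, where G = G])
    show "G {(w0, ?t)}"
      using w0 inj by (force simp: G_def le_less)
    show "fst a \<in> {1..n} \<and> q + 1 \<le> 2 * snd a" if "G A" "a \<in> A" for A a
    proof -
      have "fst a \<in> S" "snd a = ?t" using that by (auto simp: G_def)
      then show ?thesis using S(1) t(1) by auto
    qed
    fix A a assume A: "G A" "finite A" "card A < r" "a \<in> A"
    have "card (fst ` A) < card S" using A(2,3) S(2) card_image_le[of A fst] by simp
    then have "S - fst ` A \<noteq> {}" using A(2) card_mono[of "fst ` A" S] by auto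
    then obtain w where w: "w \<in> S - fst ` A"
        "\<And>w'. w' \<in> S - fst ` A \<Longrightarrow> \<tau> (w', ?t) \<le> \<tau> (w, ?t)"
      using obtain_max_image[of "S - fst ` A" "\<lambda>w. \<tau> (w, ?t)"] finS by blast
    have "G (insert (w, ?t) A)"
      unfolding G_def
    proof (intro conjI ballI)
      show "insert (w, ?t) A \<subseteq> S \<times> {?t}" using A(1) w(1) by (auto simp: G_def)
      fix w' b assume w': "w' \<in> S - fst ` insert (w, ?t) A" and b: "b \<in> insert (w, ?t) A"
      have "\<tau> (w', ?t) < \<tau> (w, ?t)"
        using w(2)[of w'] w' w(1) inj[of w' w] by (auto simp: le_less)
      then show "\<tau> (w', ?t) < \<tau> b" using b A(1) w' by (auto simp: G_def)
    qed
    moreover have "\<exists>x\<in>H. link q n x a (w, ?t)"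
    proof -
      obtain p where p: "a = (p, ?t)" "p \<in> S" using A(1,4) by (auto simp: G_def)
      have "p \<noteq> w" using w(1) A(4) p(1) by force
      have lower: "\<tau> (w, ?t) < \<tau> (p, ?t)" using A(1,4) w(1) p(1) by (auto simp: G_def)
      have "{p, w} \<in> pairs n" "{p, w} \<subseteq> S"
        using p(2) w(1) S(1) \<open>p \<noteq> w\<close> by (auto simp: pairs_def)
      then obtain u v where "{p, w} = {u, v}" "balanced q n H u v"
        using clique[of "{p, w}"] by (auto simp: unbalanced_pairs_def)
      moreover have "\<not> balanced q n H w p"
      proof
        assume "balanced q n H w p"
        then obtain x where x: "x \<in> H" "supp n x = {w, p}" "x w = ?t" "x p = q + 1 - ?t"
          by (auto simp: balanced_def)
        then have "\<tau> (p, ?t) < \<tau> (w, ?t)"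
          using t by (intro rankedD[OF assms(4) x(1,2)]) auto
        then show False using lower by simp
      qed
      ultimately have "balanced q n H p w" by (auto simp: doubleton_eq_iff)
      then show ?thesis using t p(1) by (auto simp: balanced_def link_def)
    qed
    ultimately show "\<exists>b x. G (insert b A) \<and> fst b \<notin> fst ` A \<and> x \<in> H \<and> link q n x a b"
      using w(1) by (metis DiffD2 fst_conv)
  qed
qed

section \<open>Ranking a q-graph without a copy\<close>

definition out_vertices ::
    "nat \<Rightarrow> nat \<Rightarrow> (nat \<Rightarrow> nat) set \<Rightarrow> nat \<times> nat \<Rightarrow> (nat \<times> nat) set \<Rightarrow> nat set" where
  "out_vertices q n H a A = fst ` {b \<in> A. \<exists>x\<in>H. link q n x a b}"

lemma rich_states_copy:
  assumes "is_tree V E" "card V \<le> r" "H \<subseteq> q_edges q n"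
    and A: "A \<subseteq> states q n" "A \<noteq> {}"
    and rich: "\<And>a. a \<in> A \<Longrightarrow> r \<le> card (out_vertices q n H a A)"
  shows "contains_s_copy q n (q + 1) V E H"
proof -
  obtain a0 where a0: "a0 \<in> A" using A(2) by auto
  have finA: "finite A" using A(1) states_bound(1) finite_subset by blast
  show ?thesis
  proof (rule greedy_copy[OF assms(1-3), where G = "\<lambda>B. B \<subseteq> A"])
    show "{a0} \<subseteq> A" using a0 by simp
    show "fst a \<in> {1..n} \<and> q + 1 \<le> 2 * snd a" if "B \<subseteq> A" "a \<in> B" for B a
      using that A(1) by (auto simp: states_def)
    fix B a assume B: "B \<subseteq> A" "finite B" "card B < r" "a \<in> B"
    have "card (fst ` B) < card (out_vertices q n H a A)"
      using card_image_le[OF B(2), of fst] B(3) rich[of a] B(1,4) by force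
    then have "\<not> out_vertices q n H a A \<subseteq> fst ` B"
      using card_mono[of "fst ` B"] B(2) by (meson finite_imageI leD)
    then obtain b x where "b \<in> A" "fst b \<notin> fst ` B" "x \<in> H" "link q n x a b"
      unfolding out_vertices_def by blast
    then show "\<exists>b x. insert b B \<subseteq> A \<and> fst b \<notin> fst ` B \<and> x \<in> H \<and> link q n x a b"
      using B(1) by blast
  qed
qed

text \<open>The deleted \<open>q\<close>-edges are those with a link that does not decrease the rank. There are at
  most \<open>n * q\<close> states, fewer than \<open>r\<close> vertices at the other end for each of them, and at most
  \<open>q\<^sup>2\<close> \<open>q\<close>-edges on each resulting pair.\<close>

lemma ranked_subgraph:
  assumes "is_tree V E" "card V \<le> r" and H: "H \<subseteq> q_edges q n"
    and free: "\<not> contains_s_copy q n (q + 1) V E H"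
  obtains \<tau> H' where "H' \<subseteq> H" "ranked q n \<tau> H'" "card H \<le> card H' + r * q ^ 3 * n"
proof -
  have "\<exists>a\<in>A. card (out_vertices q n H a A) < r" if "A \<subseteq> states q n" "A \<noteq> {}" for A
    using rich_states_copy[OF assms(1-3) that] free by (meson not_le_imp_less)
  then have "\<exists>\<tau>::nat \<times> nat \<Rightarrow> nat. inj_on \<tau> (states q n) \<and> (\<forall>a\<in>states q n.
      card (out_vertices q n H a {b \<in> states q n. \<tau> a \<le> \<tau> b}) < r)"
    by (rule degeneracy_order[OF states_bound(1)])
  then obtain \<tau> :: "nat \<times> nat \<Rightarrow> nat" where inj: "inj_on \<tau> (states q n)"
    and few: "\<forall>a\<in>states q n. card (out_vertices q n H a {b \<in> states q n. \<tau> a \<le> \<tau> b}) < r"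
    by blast
  let ?N = "\<lambda>a. out_vertices q n H a {b \<in> states q n. \<tau> a \<le> \<tau> b}"
  define D where "D = {x \<in> H. \<exists>a\<in>states q n. \<exists>b\<in>states q n. \<tau> a \<le> \<tau> b \<and> link q n x a b}"
  have finN: "finite (?N a)" for a
    using states_bound(1) by (auto simp: out_vertices_def)
  have finF: "finite (fibre n (q_edges q n) e)" for e
    using finite_q_edges by (simp add: fibre_def)
  have "D \<subseteq> (\<Union>a\<in>states q n. \<Union>v\<in>?N a. fibre n (q_edges q n) {fst a, v})"
  proof
    fix x assume "x \<in> D"
    then obtain a b where ab: "x \<in> H" "a \<in> states q n" "b \<in> states q n" "\<tau> a \<le> \<tau> b"
        "link q n x a b"
      unfolding D_def by blast
    then have "fst b \<in> ?N a" unfolding out_vertices_def by blast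
    moreover have "x \<in> fibre n (q_edges q n) {fst a, fst b}"
      using ab(1,5) H by (auto simp: fibre_def link_def)
    ultimately show "x \<in> (\<Union>a\<in>states q n. \<Union>v\<in>?N a. fibre n (q_edges q n) {fst a, v})"
      using ab(2) by blast
  qed
  then have "card D \<le> card (\<Union>a\<in>states q n. \<Union>v\<in>?N a. fibre n (q_edges q n) {fst a, v})"
    using states_bound(1) finN finF by (intro card_mono) auto
  also have "\<dots> \<le> (\<Sum>a\<in>states q n. card (\<Union>v\<in>?N a. fibre n (q_edges q n) {fst a, v}))"
    using states_bound(1) by (rule card_UN_le)
  also have "\<dots> \<le> (\<Sum>a\<in>states q n. r * q\<^sup>2)"
  proof (rule sum_mono)
    fix a assume a: "a \<in> states q n"
    have "card (\<Union>v\<in>?N a. fibre n (q_edges q n) {fst a, v})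
        \<le> (\<Sum>v\<in>?N a. card (fibre n (q_edges q n) {fst a, v}))"
      using finN by (rule card_UN_le)
    also have "\<dots> \<le> (\<Sum>v\<in>?N a. q\<^sup>2)" using card_fibre_le by (intro sum_mono)
    also have "\<dots> \<le> r * q\<^sup>2" using bspec[OF few a] by simp
    finally show "card (\<Union>v\<in>?N a. fibre n (q_edges q n) {fst a, v}) \<le> r * q\<^sup>2" .
  qed
  also have "\<dots> = card (states q n) * (r * q\<^sup>2)" by simp
  also have "\<dots> \<le> (n * q) * (r * q\<^sup>2)" using states_bound(2) by (rule mult_le_mono1)
  also have "\<dots> = r * q ^ 3 * n" by (simp add: power2_eq_square power3_eq_cube)
  finally have D: "card D \<le> r * q ^ 3 * n" .
  have "finite H" using H finite_q_edges finite_subset by blast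
  then have "card H \<le> card (H - D) + card D"
    using card_Un_le[of "H - D" D] card_mono[of "H - D \<union> D" H] by (auto simp: D_def)
  moreover have "ranked q n \<tau> (H - D)"
    unfolding ranked_def
  proof (intro conjI ballI impI)
    show "H - D \<subseteq> q_edges q n" using H by auto
    show "inj_on \<tau> (states q n)" by (rule inj)
    fix x a b assume "x \<in> H - D" "a \<in> states q n" "b \<in> states q n" "link q n x a b"
    then have "\<not> \<tau> a \<le> \<tau> b" unfolding D_def by blast
    then show "\<tau> b < \<tau> a" by simp
  qed
  moreover have "H - D \<subseteq> H" by auto
  ultimately show thesis using D by (intro that[of "H - D" \<tau>]) auto
qed

lemma contains_s_copy_mono:
  "contains_s_copy q n s V E H' \<Longrightarrow> H' \<subseteq> H \<Longrightarrow> contains_s_copy q n s V E H"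
  unfolding contains_s_copy_def by blast

text \<open>The number \<open>B\<close> of pairs without a balanced \<open>q\<close>-edge is the saving over the universal tree.\<close>

lemma copy_free_card:
  assumes "is_tree V E" "card V \<le> r" "2 \<le> r" "r \<le> n" "2 \<le> q"
    and H: "H \<subseteq> q_edges q n" "\<not> contains_s_copy q n (q + 1) V E H"
  obtains B where "n choose 2 \<le> B * (r choose 2)"
    "card H + B \<le> (q\<^sup>2 div 2) * (n choose 2) + r * q ^ 3 * n"
proof -
  obtain \<tau> H' where H': "H' \<subseteq> H" "ranked q n \<tau> H'" "card H \<le> card H' + r * q ^ 3 * n"
    using ranked_subgraph[OF assms(1,2) H] by blast
  let ?B = "unbalanced_pairs q n H'"
  have "n choose 2 \<le> card ?B * (r choose 2)"
  proof (rule hitting_pairs_bound[OF assms(3,4)])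
    show "?B \<subseteq> pairs n" by (auto simp: unbalanced_pairs_def)
    show "\<exists>e\<in>?B. e \<subseteq> S" if "S \<subseteq> {1..n}" "card S = r" for S
    proof (rule ccontr)
      assume "\<not> (\<exists>e\<in>?B. e \<subseteq> S)"
      then have "contains_s_copy q n (q + 1) V E H'"
        using assms(3) by (intro balanced_clique_copy[OF assms(1,2,5) H'(2) that]) auto
      then show False using contains_s_copy_mono[OF _ H'(1)] H(2) by metis
    qed
  qed
  then show thesis using that ranked_card[OF assms(5) H'(2)] H'(3) by fastforce
qed

theorem theorem1p4:
  fixes V :: "'a set" and E :: "'a set set" and q :: nat
  assumes "is_tree V E" and "q \<ge> 2"
  shows "\<exists>c::real. c > 0 \<and>
    (\<exists>N. \<forall>n\<ge>N.
       real (ex n V E q) \<le> real (card (universal_q_tree q n)) - c * real (n choose 2)) \<and>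
    (\<forall>n\<ge>1.
       real (card (universal_q_tree q n)) - c * real (n choose 2)
         = (real_of_int \<lfloor>(real q)\<^sup>2 / 2\<rfloor> - c) * real (n choose 2))"
proof -
  \<comment> \<open>The tree with one vertex is treated as if it had two, so that sets of size \<open>r\<close> contain pairs.\<close>
  define r where "r = max 2 (card V)"
  define K where "K = real (r choose 2)"
  define L where "L = r * q ^ 3"
  define m where "m = q\<^sup>2 div 2"
  define c where "c = 1 / (2 * K)"
  \<comment> \<open>From here on the linear loss \<open>L * n\<close> is at most half of the saving \<open>(n choose 2) / K\<close>.\<close>
  define N where "N = r + 4 * (r choose 2) * L + 1"
  have r: "card V \<le> r" "2 \<le> r" by (auto simp: r_def)
  have "1 \<le> r choose 2" using r(2) by (simp add: Suc_le_eq zero_less_binomial)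
  then have K: "1 \<le> K" by (simp add: K_def)
  then have c: "0 < c" "c \<le> 1 / 2" by (auto simp: c_def field_simps)
  have "2 * 2 \<le> q * q" using assms(2) by (intro mult_le_mono) auto
  then have m: "2 \<le> m" by (simp add: m_def power2_eq_square)
  have size: "real (card (universal_q_tree q n)) - c * real (n choose 2)
      = (real m - c) * real (n choose 2)" for n
    by (simp add: card_universal_q_tree m_def left_diff_distrib)
  have bound: "real (ex n V E q) \<le> (real m - c) * real (n choose 2)" if n: "N \<le> n" for n
  proof -
    let ?a = "(real m - c) * real (n choose 2)"
    have nonneg: "0 \<le> ?a" using m c(2) by (intro mult_nonneg_nonneg) auto
    have choose2: "real (n choose 2) = real n * (real n - 1) / 2"
      using n by (simp add: choose_two N_def real_of_nat_div of_nat_diff)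
    have "real N \<le> real n" using n by simp
    then have "4 * K * real L \<le> real n - 1" by (simp add: N_def K_def)
    then have "real n * (4 * K * real L) \<le> real n * (real n - 1)" by (intro mult_left_mono) auto
    then have linear: "real L * real n \<le> c * real (n choose 2)"
      using K by (simp add: choose2 c_def field_simps)
    have each: "real (card H) \<le> ?a"
      if H: "H \<subseteq> q_edges q n" "\<not> contains_s_copy q n (q + 1) V E H" for H
    proof -
      have "r \<le> n" using n by (simp add: N_def)
      then obtain B where B: "n choose 2 \<le> B * (r choose 2)"
          "card H + B \<le> m * (n choose 2) + L * n"
        using copy_free_card[OF assms(1) r _ assms(2) H] by (auto simp: m_def L_def)
      have "real (n choose 2) \<le> real B * K" unfolding K_def using B(1) of_nat_mono by fastforce
      then have "2 * c * real (n choose 2) \<le> real B" using K by (simp add: c_def field_simps)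
      moreover have "real (card H) + real B \<le> real m * real (n choose 2) + real L * real n"
        using B(2) of_nat_mono[OF B(2), where 'a = real] by simp
      ultimately show ?thesis using linear by (simp add: left_diff_distrib)
    qed
    let ?X = "{card H |H. H \<subseteq> q_edges q n \<and> \<not> contains_s_copy q n (q + 1) V E H}"
    \<comment> \<open>For the tree with one vertex the set is empty and its supremum is 0, below \<open>?a\<close> as well.\<close>
    have "Sup ?X \<le> nat \<lfloor>?a\<rfloor>"
    proof (cases "?X = {}")
      case True
      then show ?thesis by (simp only: Sup_nat_empty)
    next
      case False
      then show ?thesis using each by (intro cSup_least) (auto intro: le_nat_floor)
    qed
    then have "ex n V E q \<le> nat \<lfloor>?a\<rfloor>" by (simp only: ex_def)
    then show ?thesis using of_nat_floor[OF nonneg] by linarith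
  qed
  have "\<lfloor>(real q)\<^sup>2 / 2\<rfloor> = int m"
    using floor_divide_of_nat_eq[of "q\<^sup>2" 2, where 'a = real] by (simp add: m_def)
  then have floor: "real_of_int \<lfloor>(real q)\<^sup>2 / 2\<rfloor> = real m" by simp
  show ?thesis
  proof (intro exI[of _ c] exI[of _ N] conjI allI impI)
    show "0 < c" by (rule c(1))
    fix n
    show "real (ex n V E q) \<le> real (card (universal_q_tree q n)) - c * real (n choose 2)"
      if "N \<le> n" using bound[OF that] by (simp only: size)
    show "real (card (universal_q_tree q n)) - c * real (n choose 2)
        = (real_of_int \<lfloor>(real q)\<^sup>2 / 2\<rfloor> - c) * real (n choose 2)"
      by (simp only: size floor)
  qed
qed

end
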